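(* Let $a$, $b$ and $n>1$ be positive integers, let $\Bbbk$ be a field, set $a_i := r_b(n) + a\, r_b(i-1)$ for $i=1,\ldots,n$, and let $I$ be the kernel of the $\Bbbk$-algebra homomorphism $$\Bbbk[x_1, \ldots, x_n] \to \Bbbk[t^{a_1}, \ldots, t^{a_n}];\quad x_i \mapsto t^{a_i},\ i = 1, \ldots, n,$$ where $t$ is an indeterminate. If $\gcd(a, r_b(n)) = 1$, then the ideal $I$ is minimally generated by the $2\times 2$-minors of $$X := \left(\begin{array}{cccc} x_1^b & \ldots & x_{n-1}^b & x_n^b \\ x_2 & \ldots & x_n & x_1^{a+1} \end{array}\right).$$ In this case, if $n > 3$, then $I$ has a unique minimal system of binomial generators if and only if $a < b-1$.
   Context: For a positive integer $b$ and $\ell\ge 1$, $r_b(\ell) := \sum_{j=0}^{\ell-1} b^j$, and $r_b(0):=0$. An ideal is minimally generated by a set if the set generates the ideal and no proper subset does. A minimal system of binomial generators is a minimal generating set consisting of binomials; uniqueness is understood up to multiplying the binomials by nonzero scalars of $\Bbbk$ (in particular, up to sign). *)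

theory Defs
  imports
    "HOL-Library.Poly_Mapping"
    "HOL-Computational_Algebra.Polynomial"
    "HOL-Algebra.Algebraic_Closure_Type"
begin

definition rb :: "nat \<Rightarrow> nat \<Rightarrow> nat"
  where "rb b l = (\<Sum>j<l. b ^ j)"


text \<open>
  Polynomials in variables indexed by the natural numbers are finitely supported maps from
  monomials (finitely supported exponent vectors) to coefficients; their multiplication is the
  convolution product.  The ring of polynomials in \<open>x\<^sub>1, \<dots>, x\<^sub>n\<close> has as its carrier the
  polynomials in which only these variables occur.
\<close>

type_synonym 'k mpoly = "(nat \<Rightarrow>\<^sub>0 nat) \<Rightarrow>\<^sub>0 'k"

definition mpoly_ring :: "nat \<Rightarrow> 'k::field mpoly ring"
  where "mpoly_ring n =
    ring_of_type_algebra\<lparr>carrier := {p. \<forall>m \<in> Poly_Mapping.keys p. Poly_Mapping.keys m \<subseteq> {1..n}}\<rparr>"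

definition var :: "nat \<Rightarrow> 'k::field mpoly"
  where "var i = Poly_Mapping.single (Poly_Mapping.single i 1) 1"

definition const :: "'k::field \<Rightarrow> 'k mpoly"
  where "const c = Poly_Mapping.single 0 c"


text \<open>
  The homomorphism \<open>x\<^sub>i \<mapsto> t\<^sup>A\<^sup>i\<close>.  It is taken with codomain \<open>\<bbbk>[t]\<close>, of which
  \<open>\<bbbk>[t\<^sup>A\<^sup>1, \<dots>, t\<^sup>A\<^sup>n]\<close> is a subring; this does not affect the kernel.
\<close>

definition toric_hom :: "nat \<Rightarrow> (nat \<Rightarrow> nat) \<Rightarrow> 'k::field mpoly \<Rightarrow> 'k poly"
  where "toric_hom n A p =
    (\<Sum>m \<in> Poly_Mapping.keys p.
       [:Poly_Mapping.lookup p m:] * (\<Prod>i\<in>{1..n}. monom 1 (A i) ^ Poly_Mapping.lookup m i))"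

definition toric_ideal :: "nat \<Rightarrow> (nat \<Rightarrow> nat) \<Rightarrow> 'k::field mpoly set"
  where "toric_ideal n A = a_kernel (mpoly_ring n) ring_of_type_algebra (toric_hom n A)"


definition minimally_generates :: "('r, 'm) ring_scheme \<Rightarrow> 'r set \<Rightarrow> 'r set \<Rightarrow> bool"
  where "minimally_generates R S I \<longleftrightarrow>
    S \<subseteq> carrier R \<and> genideal R S = I \<and> (\<forall>T. T \<subset> S \<longrightarrow> genideal R T \<noteq> I)"

definition is_binomial :: "'k::field mpoly \<Rightarrow> bool"
  where "is_binomial f \<longleftrightarrow>
    (\<exists>u v c d. u \<noteq> v \<and> c \<noteq> 0 \<and> d \<noteq> 0 \<and> f = Poly_Mapping.single u c + Poly_Mapping.single v d)"

definition minimal_binomial_system :: "nat \<Rightarrow> 'k::field mpoly set \<Rightarrow> 'k mpoly set \<Rightarrow> bool"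
  where "minimal_binomial_system n I B \<longleftrightarrow>
    minimally_generates (mpoly_ring n) B I \<and> (\<forall>f\<in>B. is_binomial f)"

definition equal_up_to_scalars :: "'k::field mpoly set \<Rightarrow> 'k mpoly set \<Rightarrow> bool"
  where "equal_up_to_scalars B B' \<longleftrightarrow>
    (\<forall>f\<in>B. \<exists>c. c \<noteq> 0 \<and> const c * f \<in> B') \<and> (\<forall>g\<in>B'. \<exists>c. c \<noteq> 0 \<and> const c * g \<in> B)"

definition has_unique_minimal_binomial_system :: "nat \<Rightarrow> 'k::field mpoly set \<Rightarrow> bool"
  where "has_unique_minimal_binomial_system n I \<longleftrightarrow>
    (\<exists>B. minimal_binomial_system n I B \<and>
         (\<forall>B'. minimal_binomial_system n I B' \<longrightarrow> equal_up_to_scalars B B'))"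


text \<open>Matrices with two rows are functions of a row index in \<open>{1, 2}\<close> and a column index in
  \<open>{1..n}\<close>.\<close>

definition minors2 :: "nat \<Rightarrow> (nat \<Rightarrow> nat \<Rightarrow> 'r::comm_ring_1) \<Rightarrow> 'r set"
  where "minors2 n M = {M 1 i * M 2 j - M 1 j * M 2 i | i j. 1 \<le> i \<and> i < j \<and> j \<le> n}"

definition matX :: "nat \<Rightarrow> nat \<Rightarrow> nat \<Rightarrow> nat \<Rightarrow> nat \<Rightarrow> 'k::field mpoly"
  where "matX a b n r j =
    (if r = 1 then var j ^ b
     else if j < n then var (j + 1)
     else var 1 ^ (a + 1))"


text \<open>
  The structures above are what they should be: \<open>mpoly_ring n\<close> is a commutative ring, and
  \<open>toric_hom n A\<close> is the \<open>\<bbbk>\<close>-algebra homomorphism determined by \<open>x\<^sub>i \<mapsto> t\<^sup>A\<^sup>i\<close>.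
\<close>

lemma mpoly_ring_simps [simp]:
  "carrier (mpoly_ring n) = {p. \<forall>m \<in> Poly_Mapping.keys p. Poly_Mapping.keys m \<subseteq> {1..n}}"
  "p \<otimes>\<^bsub>mpoly_ring n\<^esub> q = p * q" "p \<oplus>\<^bsub>mpoly_ring n\<^esub> q = p + q"
  "\<one>\<^bsub>mpoly_ring n\<^esub> = 1" "\<zero>\<^bsub>mpoly_ring n\<^esub> = 0"
  by (simp_all add: mpoly_ring_def ring_of_type_algebra_def)

lemma keys_add_nat:
  "Poly_Mapping.keys (m + m' :: nat \<Rightarrow>\<^sub>0 nat) = Poly_Mapping.keys m \<union> Poly_Mapping.keys m'"
  by (auto simp: in_keys_iff lookup_add)

lemma cring_mpoly_ring: "cring (mpoly_ring n :: 'k::field mpoly ring)"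
proof (rule cringI)
  show "abelian_group (mpoly_ring n :: 'k mpoly ring)"
  proof (rule abelian_groupI)
    fix x y :: "'k mpoly"
    assume xy: "x \<in> carrier (mpoly_ring n)" "y \<in> carrier (mpoly_ring n)"
    show "x \<oplus>\<^bsub>mpoly_ring n\<^esub> y \<in> carrier (mpoly_ring n)"
      using xy keys_add[of x y] by (simp, blast)
  next
    fix x :: "'k mpoly"
    assume "x \<in> carrier (mpoly_ring n)"
    then show "\<exists>y\<in>carrier (mpoly_ring n). y \<oplus>\<^bsub>mpoly_ring n\<^esub> x = \<zero>\<^bsub>mpoly_ring n\<^esub>"
      by (intro bexI[of _ "- x"]) auto
  qed (auto simp: algebra_simps)
  show "comm_monoid (mpoly_ring n :: 'k mpoly ring)"
  proof (rule comm_monoidI)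
    fix x y :: "'k mpoly"
    assume xy: "x \<in> carrier (mpoly_ring n)" "y \<in> carrier (mpoly_ring n)"
    show "x \<otimes>\<^bsub>mpoly_ring n\<^esub> y \<in> carrier (mpoly_ring n)"
    proof (simp, intro ballI)
      fix m assume "m \<in> Poly_Mapping.keys (x * y)"
      then obtain u v where "u \<in> Poly_Mapping.keys x" "v \<in> Poly_Mapping.keys y" "m = u + v"
        using keys_mult[of x y] by blast
      then show "Poly_Mapping.keys m \<subseteq> {Suc 0..n}"
        using xy by (auto simp: keys_add_nat)
    qed
  qed (auto simp: algebra_simps)
qed (auto simp: algebra_simps)

lemma const_carrier: "const c \<in> carrier (mpoly_ring n)"
  by (simp add: const_def)

lemma var_carrier: "i \<in> {1..n} \<Longrightarrow> var i \<in> carrier (mpoly_ring n)"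
  by (simp add: var_def)

lemma toric_hom_superset:
  assumes "finite S" "Poly_Mapping.keys p \<subseteq> S"
  shows "toric_hom n A p =
    (\<Sum>m\<in>S. [:Poly_Mapping.lookup p m:] * (\<Prod>i\<in>{1..n}. monom 1 (A i) ^ Poly_Mapping.lookup m i))"
  unfolding toric_hom_def using assms by (intro sum.mono_neutral_left) (auto simp: in_keys_iff)

lemma toric_hom_single:
  "toric_hom n A (Poly_Mapping.single m c) =
    [:c:] * (\<Prod>i\<in>{1..n}. monom 1 (A i) ^ Poly_Mapping.lookup m i)"
  by (subst toric_hom_superset[of "{m}"]) (auto split: if_splits)

lemma toric_hom_zero: "toric_hom n A 0 = 0"
  by (simp add: toric_hom_def)

lemma toric_hom_add: "toric_hom n A (p + q) = toric_hom n A p + toric_hom n A q"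
proof -
  let ?S = "Poly_Mapping.keys p \<union> Poly_Mapping.keys q"
  show ?thesis
    using keys_add[of p q]
    by (simp add: toric_hom_superset[of ?S] lookup_add smult_add_left sum.distrib)
qed

lemma toric_hom_sum: "toric_hom n A (\<Sum>x\<in>S. f x) = (\<Sum>x\<in>S. toric_hom n A (f x))"
  by (induction S rule: infinite_finite_induct) (simp_all add: toric_hom_zero toric_hom_add)

lemma sum_single:
  "(\<Sum>m\<in>Poly_Mapping.keys p. Poly_Mapping.single m (Poly_Mapping.lookup p m)) = p"
proof (rule poly_mapping_eqI)
  fix k
  have "(\<Sum>m\<in>Poly_Mapping.keys p. Poly_Mapping.lookup p m when m = k) = Poly_Mapping.lookup p k"
    by (simp add: when_def in_keys_iff)
  then show "Poly_Mapping.lookup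
      (\<Sum>m\<in>Poly_Mapping.keys p. Poly_Mapping.single m (Poly_Mapping.lookup p m)) k =
    Poly_Mapping.lookup p k"
    by (simp add: lookup_sum lookup_single)
qed

lemma toric_hom_mult: "toric_hom n A (p * q) = toric_hom n A p * toric_hom n A q"
proof -
  have mono: "toric_hom n A (Poly_Mapping.single u c * Poly_Mapping.single v d) =
      toric_hom n A (Poly_Mapping.single u c) * toric_hom n A (Poly_Mapping.single v d)"
    for u v and c d :: 'a
  proof -
    have "[:c * d:] = [:c:] * [:d:]" by simp
    then show ?thesis
      unfolding mult_single toric_hom_single lookup_add power_add prod.distrib
      by (simp only: mult_ac)
  qed
  have "toric_hom n A (p * q) = toric_hom n A
      ((\<Sum>u\<in>Poly_Mapping.keys p. Poly_Mapping.single u (Poly_Mapping.lookup p u)) *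
       (\<Sum>v\<in>Poly_Mapping.keys q. Poly_Mapping.single v (Poly_Mapping.lookup q v)))"
    by (simp only: sum_single)
  also have "\<dots> =
      toric_hom n A (\<Sum>u\<in>Poly_Mapping.keys p. Poly_Mapping.single u (Poly_Mapping.lookup p u)) *
      toric_hom n A (\<Sum>v\<in>Poly_Mapping.keys q. Poly_Mapping.single v (Poly_Mapping.lookup q v))"
    by (simp only: sum_product toric_hom_sum mono)
  finally show ?thesis
    by (simp only: sum_single)
qed

lemma toric_hom_const: "toric_hom n A (const c) = [:c:]"
  by (simp add: const_def toric_hom_single)

lemma toric_hom_var:
  assumes "i \<in> {1..n}"
  shows "toric_hom n A (var i) = monom 1 (A i)"
proof -
  have "(\<Prod>j\<in>{1..n}. monom (1::'a) (A j) ^ Poly_Mapping.lookup (Poly_Mapping.single i 1) j) =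
      (\<Prod>j\<in>{1..n}. if j = i then monom 1 (A j) else 1)"
    by (intro prod.cong) (auto simp: lookup_single)
  then show ?thesis
    using assms by (simp add: var_def toric_hom_single)
qed

lemma toric_hom_ring_hom: "toric_hom n A \<in> ring_hom (mpoly_ring n) ring_of_type_algebra"
  using toric_hom_const[of n A 1]
  by (intro ring_hom_memI)
     (simp_all add: ring_of_type_algebra_def toric_hom_add toric_hom_mult const_def flip: one_pCons)

lemma toric_ideal_eq: "toric_ideal n A = {p \<in> carrier (mpoly_ring n). toric_hom n A p = 0}"
  by (simp add: toric_ideal_def a_kernel_def kernel_def ring_of_type_algebra_def)

end

theory Submission
  imports Defs
begin

text \<open>
  Each minor is the difference of two monomials \<open>x\<^sub>i\<^sup>b x\<^sub>j\<^sub>+\<^sub>1\<close> and \<open>x\<^sub>j\<^sup>b x\<^sub>i\<^sub>+\<^sub>1\<close>, where \<open>x\<^sub>n\<^sub>+\<^sub>1\<close> stands for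
  \<open>x\<^sub>1\<^sup>a\<^sup>+\<^sup>1\<close>.  They have the same image \<open>t\<^sup>d\<close>, because \<open>a\<^sub>j\<^sub>+\<^sub>1 - b a\<^sub>j\<close> does not depend on \<open>j\<close>
  (with \<open>(a + 1) a\<^sub>1\<close> for \<open>a\<^sub>n\<^sub>+\<^sub>1\<close>).

  Generation.  Rewriting \<open>x\<^sub>j\<^sup>b x\<^sub>i\<^sub>+\<^sub>1\<close> to \<open>x\<^sub>i\<^sup>b x\<^sub>j\<^sub>+\<^sub>1\<close> for \<open>i < j\<close> terminates
  (\<open>reduces_to_normal_form\<close>).  The exponents of \<open>x\<^sub>2, \<dots>, x\<^sub>n\<close> in an irreducible monomial are the digits of a
  greedy expansion by the repunits \<open>r\<^sub>b(1), \<dots>, r\<^sub>b(n - 1)\<close>, whose values are less than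
  \<open>r\<^sub>b(n) = a\<^sub>1\<close>.  Because \<open>a\<close> is coprime to \<open>r\<^sub>b(n)\<close>, the image \<open>t\<^sup>d\<close> determines this value and with it the
  monomial (\<open>reduced_unique\<close>).  So monomials with the same image are congruent modulo the minors, and
  the differences of such monomials span \<open>I\<close> (\<open>toric_ideal_subset\<close>).

  Minimality.  For each minor there is a set \<open>C\<close> of monomials of total degree \<open>b + 1\<close> such that the sum
  of the coefficients at \<open>C\<close> is not 0 on this minor but vanishes on all multiples of the others
  (\<open>separating_functional\<close>).

  Uniqueness.  If \<open>a + 1 < b\<close>, the only term of a minor that divides a monomial of a given minor is that
  monomial itself, so the two monomials of a minor are the only ones with their image.  They are
  coprime, and therefore every binomial generating system contains a scalar multiple of their
  difference (\<open>minor_indispensable\<close>).  If \<open>b \<le> a + 1\<close> and \<open>n > 3\<close>, the minor of columns 3 and \<open>n\<close> can be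
  exchanged for another binomial, obtained by rewriting one of its monomials with the minor of columns
  1 and 2 (\<open>not_unique_if_ge\<close>).
\<close>

section \<open>Weights and sums of coefficients\<close>

definition weight :: "(nat \<Rightarrow> nat) \<Rightarrow> (nat \<Rightarrow>\<^sub>0 nat) \<Rightarrow> nat"
  where "weight w m = (\<Sum>k\<in>Poly_Mapping.keys m. w k * Poly_Mapping.lookup m k)"

lemma weight_superset:
  assumes "finite S" "Poly_Mapping.keys m \<subseteq> S"
  shows "weight w m = (\<Sum>k\<in>S. w k * Poly_Mapping.lookup m k)"
  unfolding weight_def using assms by (intro sum.mono_neutral_left) (auto simp: in_keys_iff)

lemma weight_add [simp]: "weight w (m + m') = weight w m + weight w m'"
proof -
  let ?S = "Poly_Mapping.keys m \<union> Poly_Mapping.keys m'"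
  show ?thesis
    by (simp add: weight_superset[of ?S] keys_add_nat lookup_add sum.distrib distrib_left)
qed

lemma weight_single [simp]: "weight w (Poly_Mapping.single k e) = w k * e"
  by (subst weight_superset[of "{k}"]) auto

definition total_degree :: "(nat \<Rightarrow>\<^sub>0 nat) \<Rightarrow> nat"
  where "total_degree m = weight (\<lambda>_. 1) m"

lemma total_degree_simps [simp]:
  "total_degree (m + m') = total_degree m + total_degree m'"
  "total_degree (Poly_Mapping.single k e) = e"
  by (simp_all add: total_degree_def)

lemma total_degree_eq_0_iff: "total_degree m = 0 \<longleftrightarrow> m = 0"
  by (auto simp: total_degree_def weight_def in_keys_iff intro!: poly_mapping_eqI)

text \<open>
  These linear functionals show that a polynomial is not in an ideal: for a suitable \<open>C\<close> they vanish on
  the ideal, but not on the polynomial.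
\<close>

definition coeff_sum :: "(nat \<Rightarrow>\<^sub>0 nat) set \<Rightarrow> 'k::field mpoly \<Rightarrow> 'k"
  where "coeff_sum C p = (\<Sum>u\<in>Poly_Mapping.keys p \<inter> C. Poly_Mapping.lookup p u)"

lemma coeff_sum_superset:
  assumes "finite S" "Poly_Mapping.keys p \<subseteq> S"
  shows "coeff_sum C p = (\<Sum>u\<in>S. if u \<in> C then Poly_Mapping.lookup p u else 0)"
proof -
  have "coeff_sum C p = (\<Sum>u\<in>S \<inter> C. Poly_Mapping.lookup p u)"
    unfolding coeff_sum_def using assms by (intro sum.mono_neutral_left) (auto simp: in_keys_iff)
  then show ?thesis
    using assms(1) by (simp add: sum.inter_restrict)
qed

lemma coeff_sum_zero [simp]: "coeff_sum C 0 = 0"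
  by (simp add: coeff_sum_def)

lemma coeff_sum_add [simp]: "coeff_sum C (p + q) = coeff_sum C p + coeff_sum C q"
proof -
  let ?S = "Poly_Mapping.keys p \<union> Poly_Mapping.keys q"
  have "coeff_sum C (p + q) =
      (\<Sum>u\<in>?S. (if u \<in> C then Poly_Mapping.lookup p u else 0) +
        (if u \<in> C then Poly_Mapping.lookup q u else 0))"
    using keys_add[of p q]
    by (subst coeff_sum_superset[of ?S]) (auto simp: lookup_add intro!: sum.cong)
  then show ?thesis
    unfolding sum.distrib by (subst (1 2) coeff_sum_superset[of ?S]) auto
qed

lemma coeff_sum_uminus [simp]: "coeff_sum C (- p) = - coeff_sum C p"
proof -
  have "coeff_sum C p + coeff_sum C (- p) = 0"
    by (simp flip: coeff_sum_add)
  then show ?thesis by (rule minus_unique[symmetric])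
qed

lemma coeff_sum_diff [simp]: "coeff_sum C (p - q) = coeff_sum C p - coeff_sum C q"
  unfolding diff_conv_add_uminus coeff_sum_add coeff_sum_uminus ..

lemma coeff_sum_sum: "coeff_sum C (\<Sum>x\<in>S. f x) = (\<Sum>x\<in>S. coeff_sum C (f x))"
  by (induction S rule: infinite_finite_induct) simp_all

lemma coeff_sum_single [simp]:
  "coeff_sum C (Poly_Mapping.single u c) = (if u \<in> C then c else 0)"
  by (subst coeff_sum_superset[of "{u}"]) (auto split: if_splits)

text \<open>
  The polynomials all of whose multiples are killed by a linear functional form an ideal.  Hence, to
  see that a functional kills the ideal generated by \<open>S\<close>, it suffices to look at the multiples of the
  elements of \<open>S\<close> by terms.
\<close>

lemma coeff_sum_vanishes_on_genideal:
  fixes S :: "'a::field mpoly set"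
  assumes S: "S \<subseteq> carrier (mpoly_ring n)"
    and vanish: "\<And>g m c. g \<in> S \<Longrightarrow> Poly_Mapping.keys m \<subseteq> {1..n} \<Longrightarrow>
      coeff_sum C (Poly_Mapping.single m c * g) = 0"
    and p: "p \<in> genideal (mpoly_ring n) S"
  shows "coeff_sum C p = 0"
proof -
  interpret R: cring "mpoly_ring n :: 'a mpoly ring" by (rule cring_mpoly_ring)
  define Z :: "'a mpoly set"
    where "Z = {p \<in> carrier (mpoly_ring n).
      \<forall>q\<in>carrier (mpoly_ring n). coeff_sum C (q * p) = 0}"
  have a_inv: "\<ominus>\<^bsub>mpoly_ring n\<^esub> p = - p" if "p \<in> carrier (mpoly_ring n)" for p :: "'a mpoly"
    by (rule R.minus_equality) (use that in auto)
  have "ideal Z (mpoly_ring n)"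
  proof (rule idealI)
    show "ring (mpoly_ring n :: 'a mpoly ring)" by (rule R.ring_axioms)
    show "subgroup Z (add_monoid (mpoly_ring n))"
    proof (rule R.add.subgroupI)
      show "Z \<subseteq> carrier (mpoly_ring n)" by (auto simp: Z_def)
      show "Z \<noteq> {}" by (auto simp: Z_def intro!: exI[of _ 0])
    next
      fix x assume "x \<in> Z"
      then show "\<ominus>\<^bsub>mpoly_ring n\<^esub> x \<in> Z"
        by (subst a_inv) (auto simp: Z_def)
    next
      fix x y assume "x \<in> Z" "y \<in> Z"
      then show "x \<oplus>\<^bsub>mpoly_ring n\<^esub> y \<in> Z"
        using R.a_closed[of x y] by (auto simp: Z_def distrib_left)
    qed
  next
    fix p x :: "'a mpoly"
    assume xp: "p \<in> Z" "x \<in> carrier (mpoly_ring n)"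
    have *: "coeff_sum C (q * (x * p)) = 0" if "q \<in> carrier (mpoly_ring n)" for q
      using xp R.m_closed[OF that xp(2)] unfolding Z_def by (simp flip: mult.assoc)
    have px: "x * p \<in> carrier (mpoly_ring n)"
      using xp R.m_closed[of x p] unfolding Z_def by simp
    show xpZ: "x \<otimes>\<^bsub>mpoly_ring n\<^esub> p \<in> Z"
      unfolding Z_def using * px by simp
    show "p \<otimes>\<^bsub>mpoly_ring n\<^esub> x \<in> Z"
      using xpZ by (simp add: mult.commute)
  qed
  moreover have "S \<subseteq> Z"
  proof
    fix g assume g: "g \<in> S"
    have "coeff_sum C (q * g) = 0" if q: "q \<in> carrier (mpoly_ring n)" for q
    proof -
      have "q * g = (\<Sum>m\<in>Poly_Mapping.keys q. Poly_Mapping.single m (Poly_Mapping.lookup q m) * g)"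
        by (simp only: sum_single flip: sum_distrib_right)
      then show ?thesis
        using vanish[OF g] q by (simp add: coeff_sum_sum)
    qed
    then show "g \<in> Z" using g S by (auto simp: Z_def)
  qed
  ultimately have "p \<in> Z"
    using R.genideal_minimal p by blast
  moreover have "1 \<in> carrier (mpoly_ring n)" using R.one_closed by simp
  ultimately have "coeff_sum C (1 * p) = 0"
    unfolding Z_def by blast
  then show ?thesis by simp
qed

text \<open>
  A functional that kills the ideal generated by the other elements but not \<open>f\<close> shows that \<open>f\<close> cannot
  be omitted.
\<close>

lemma minimally_generates_if_separated:
  assumes S: "S \<subseteq> carrier (mpoly_ring n)" "genideal (mpoly_ring n) S = I"
    and sep: "\<And>f. f \<in> S \<Longrightarrow> \<exists>C. coeff_sum C f \<noteq> 0 \<and>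
      (\<forall>g\<in>S - {f}. \<forall>m c. coeff_sum C (Poly_Mapping.single m c * g) = 0)"
  shows "minimally_generates (mpoly_ring n) S I"
  unfolding minimally_generates_def
proof (intro conjI allI impI notI)
  fix T assume T: "T \<subset> S" "genideal (mpoly_ring n) T = I"
  then obtain f where f: "f \<in> S" "f \<notin> T" by blast
  obtain C where C: "coeff_sum C f \<noteq> 0"
    "\<And>g m c. g \<in> S - {f} \<Longrightarrow> coeff_sum C (Poly_Mapping.single m c * g) = 0"
    using sep[OF f(1)] by blast
  interpret R: cring "mpoly_ring n :: 'a mpoly ring" by (rule cring_mpoly_ring)
  have "f \<in> genideal (mpoly_ring n) T"
    using R.genideal_self[OF S(1)] S(2) T(2) f(1) by blast
  then have "coeff_sum C f = 0"
    using T(1) S(1) f(2) by (intro coeff_sum_vanishes_on_genideal[of T n C f] C(2)) auto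
  with C(1) show False by simp
qed (use S in auto)

section \<open>Toric ideals and differences of monomials\<close>

lemma ideal_mpoly_ring_closed:
  fixes J :: "'a::field mpoly set"
  assumes "ideal J (mpoly_ring n)"
  shows "p \<in> J \<Longrightarrow> q \<in> J \<Longrightarrow> p + q \<in> J"
    and "p \<in> J \<Longrightarrow> x \<in> carrier (mpoly_ring n) \<Longrightarrow> x * p \<in> J"
    and "p \<in> J \<Longrightarrow> q \<in> J \<Longrightarrow> p - q \<in> J"
    and "0 \<in> J"
    and "p \<in> J \<Longrightarrow> p \<in> carrier (mpoly_ring n)"
proof -
  interpret ideal J "mpoly_ring n :: 'a mpoly ring" by (rule assms)
  show add: "p + q \<in> J" if "p \<in> J" "q \<in> J" for p q
    using additive_subgroup.a_closed[OF is_additive_subgroup that] by simp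
  show mult: "x * p \<in> J" if "p \<in> J" "x \<in> carrier (mpoly_ring n)" for p x
    using I_l_closed[OF that] by simp
  have neg: "- p \<in> J" if "p \<in> J" for p
  proof -
    have "const (- 1) * p \<in> J" by (rule mult[OF that const_carrier])
    moreover have "const (- 1) = (- 1 :: 'a mpoly)"
      by (simp add: const_def single_uminus)
    ultimately show ?thesis by simp
  qed
  show "p \<in> J \<Longrightarrow> q \<in> J \<Longrightarrow> p - q \<in> J" using add[OF _ neg, of p q] by simp
  show "0 \<in> J" using additive_subgroup.zero_closed[OF is_additive_subgroup] by simp
  show "p \<in> J \<Longrightarrow> p \<in> carrier (mpoly_ring n)" using Icarr by blast
qed

definition monomial :: "(nat \<Rightarrow>\<^sub>0 nat) \<Rightarrow> 'k::field mpoly"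
  where "monomial m = Poly_Mapping.single m 1"

lemma monomial_mult: "monomial m * monomial m' = monomial (m + m')"
  by (simp add: monomial_def mult_single)

lemma monomial_carrier: "Poly_Mapping.keys m \<subseteq> {1..n} \<Longrightarrow> monomial m \<in> carrier (mpoly_ring n)"
  by (simp add: monomial_def)

lemma var_power: "var i ^ e = monomial (Poly_Mapping.single i e)"
proof (induction e)
  case 0
  show ?case by (simp add: monomial_def)
next
  case (Suc e)
  then show ?case
    by (simp add: monomial_def var_def mult_single flip: single_add)
qed

lemma single_times_binomial:
  "Poly_Mapping.single m c * (monomial s - monomial t) =
    Poly_Mapping.single (m + s) c - Poly_Mapping.single (m + t) c"
  by (simp add: monomial_def mult_single right_diff_distrib)

lemma const_inverse_mult: "c \<noteq> 0 \<Longrightarrow> const (inverse c) * (const c * f) = f"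
  by (simp add: const_def mult_single flip: mult.assoc)

lemma toric_hom_single_weight:
  assumes "Poly_Mapping.keys m \<subseteq> {1..n}"
  shows "toric_hom n A (Poly_Mapping.single m c) = monom c (weight A m)"
proof -
  have "(\<Prod>i\<in>F. monom (1::'a) (A i) ^ Poly_Mapping.lookup m i) =
      monom 1 (\<Sum>i\<in>F. A i * Poly_Mapping.lookup m i)" for F
    by (induction F rule: infinite_finite_induct) (simp_all add: monom_power mult_monom mult.commute)
  then show ?thesis
    using assms by (simp add: toric_hom_single weight_superset[of "{1..n}"] smult_monom)
qed

lemma coeff_toric_hom:
  assumes "p \<in> carrier (mpoly_ring n)"
  shows "coeff (toric_hom n A p) d =
    (\<Sum>m\<in>Poly_Mapping.keys p. if weight A m = d then Poly_Mapping.lookup p m else 0)"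
proof -
  have "toric_hom n A p = (\<Sum>m\<in>Poly_Mapping.keys p.
      toric_hom n A (Poly_Mapping.single m (Poly_Mapping.lookup p m)))"
    by (simp only: sum_single flip: toric_hom_sum)
  also have "\<dots> = (\<Sum>m\<in>Poly_Mapping.keys p. monom (Poly_Mapping.lookup p m) (weight A m))"
    using assms by (intro sum.cong toric_hom_single_weight) auto
  finally have "toric_hom n A p =
      (\<Sum>m\<in>Poly_Mapping.keys p. monom (Poly_Mapping.lookup p m) (weight A m))" .
  then show ?thesis by (simp add: coeff_sum)
qed

text \<open>
  A toric ideal is spanned by differences of monomials of the same weight: in a polynomial of the
  ideal no monomial can be alone in its weight, since the coefficients in each weight add up to 0.
  Subtracting a multiple of the difference of two monomials of the same weight removes one monomial
  and introduces no new one.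
\<close>

lemma toric_ideal_subset:
  fixes J :: "'a::field mpoly set"
  assumes J: "ideal J (mpoly_ring n)"
    and binomials: "\<And>u v. Poly_Mapping.keys u \<subseteq> {1..n} \<Longrightarrow> Poly_Mapping.keys v \<subseteq> {1..n} \<Longrightarrow>
      weight A u = weight A v \<Longrightarrow> monomial u - monomial v \<in> J"
  shows "toric_ideal n A \<subseteq> J"
proof
  fix p :: "'a mpoly"
  assume "p \<in> toric_ideal n A"
  then show "p \<in> J"
  proof (induction "card (Poly_Mapping.keys p)" arbitrary: p rule: less_induct)
    case less
    note p = less.prems[unfolded toric_ideal_eq]
    show ?case
    proof (cases "p = 0")
      case True
      then show ?thesis using ideal_mpoly_ring_closed(4)[OF J] by simp
    next
      case False
      then obtain u where u: "u \<in> Poly_Mapping.keys p"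
        using keys_eq_empty[of p] by blast
      have "\<exists>v\<in>Poly_Mapping.keys p - {u}. weight A v = weight A u"
      proof (rule ccontr)
        assume no: "\<not> ?thesis"
        have "coeff (toric_hom n A p) (weight A u) =
            (\<Sum>m\<in>Poly_Mapping.keys p. if m = u then Poly_Mapping.lookup p m else 0)"
          unfolding coeff_toric_hom[OF conjunct1[OF p[simplified mem_Collect_eq]]]
          using no by (intro sum.cong) auto
        also have "\<dots> = Poly_Mapping.lookup p u" using u by simp
        finally show False using p u by (simp add: in_keys_iff)
      qed
      then obtain v where v: "v \<in> Poly_Mapping.keys p" "v \<noteq> u" "weight A v = weight A u" by blast
      have uv: "Poly_Mapping.keys u \<subseteq> {1..n}" "Poly_Mapping.keys v \<subseteq> {1..n}"
        using p u v by auto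
      define h where "h = const (Poly_Mapping.lookup p u) * (monomial u - monomial v)"
      have h: "h = Poly_Mapping.single u (Poly_Mapping.lookup p u)
          - Poly_Mapping.single v (Poly_Mapping.lookup p u)"
        by (simp add: h_def const_def single_times_binomial)
      have hJ: "h \<in> J"
        unfolding h_def using binomials[OF uv] v(3)
        by (intro ideal_mpoly_ring_closed(2)[OF J] const_carrier) simp
      have keys: "Poly_Mapping.keys (p - h) \<subseteq> Poly_Mapping.keys p - {u}"
        using u v by (auto simp: h in_keys_iff lookup_minus lookup_single when_def split: if_splits)
      have "toric_hom n A p = toric_hom n A (p - h) + toric_hom n A h"
        by (simp flip: toric_hom_add)
      moreover have "toric_hom n A (h + Poly_Mapping.single v (Poly_Mapping.lookup p u)) =
          toric_hom n A (Poly_Mapping.single u (Poly_Mapping.lookup p u))"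
        by (simp add: h)
      ultimately have "toric_hom n A (p - h) = 0"
        using p v(3) uv by (simp add: toric_hom_add toric_hom_single_weight)
      moreover have "p - h \<in> carrier (mpoly_ring n)"
        using keys conjunct1[OF p[simplified mem_Collect_eq]] by auto
      moreover have "card (Poly_Mapping.keys (p - h)) < card (Poly_Mapping.keys p)"
        using keys u by (intro psubset_card_mono) auto
      ultimately have "p - h \<in> J"
        using less.hyps by (simp add: toric_ideal_eq)
      then have "p - h + h \<in> J" by (rule ideal_mpoly_ring_closed(1)[OF J _ hJ])
      then show ?thesis by simp
    qed
  qed
qed

lemma ideal_toric_ideal:
  "ideal (toric_ideal n A) (mpoly_ring n :: 'k::field mpoly ring)"
proof -
  interpret R: cring "mpoly_ring n :: 'k mpoly ring" by (rule cring_mpoly_ring)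
  show ?thesis
    unfolding toric_ideal_def
    by (intro ring_hom_ring.kernel_is_ideal ring_hom_ringI2 toric_hom_ring_hom
        R.ring_axioms ring_from_type_algebra)
qed

lemma binomial_in_toric_ideal:
  assumes "Poly_Mapping.keys u \<subseteq> {1..n}" "Poly_Mapping.keys v \<subseteq> {1..n}"
    and "weight A u = weight A v"
  shows "monomial u - monomial v \<in> toric_ideal n A"
proof -
  have "toric_hom n A (monomial u - monomial v) + toric_hom n A (monomial v) =
      toric_hom n A (monomial u)"
    by (simp flip: toric_hom_add)
  moreover have "monomial u - monomial v \<in> carrier (mpoly_ring n)"
    using assms keys_diff[of "monomial u" "monomial v"] by (auto simp: monomial_def)
  ultimately show ?thesis
    using assms by (simp add: toric_ideal_eq monomial_def toric_hom_single_weight)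
qed

lemma toric_ideal_cong:
  assumes "\<And>i. i \<in> {1..n} \<Longrightarrow> A i = A' i"
  shows "toric_ideal n A = (toric_ideal n A' :: 'k::field mpoly set)"
proof -
  have "toric_hom n A p = toric_hom n A' p" for p :: "'k mpoly"
    unfolding toric_hom_def using assms by (auto intro!: sum.cong prod.cong)
  then show ?thesis by (simp add: toric_ideal_eq)
qed

section \<open>Greedy expansions by repunits\<close>

lemma rb_0 [simp]: "rb b 0 = 0"
  by (simp add: rb_def)

lemma rb_Suc: "rb b (Suc l) = b * rb b l + 1"
  by (simp add: rb_def sum.lessThan_Suc_shift sum_distrib_left del: sum.lessThan_Suc)

text \<open>
  Greedy expansions with respect to the repunits \<open>rb b 1, rb b 2, \<dots>\<close>.  Since
  \<open>rb b (j + 1) = b * rb b j + 1\<close>, a digit \<open>b\<close> at position \<open>j\<close> already brings the value to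
  \<open>rb b (j + 1) - 1\<close>, and this leaves room only for zeros at the lower positions.
\<close>

definition repunit_digits :: "nat \<Rightarrow> nat \<Rightarrow> (nat \<Rightarrow> nat) \<Rightarrow> bool"
  where "repunit_digits b n d \<longleftrightarrow>
    (\<forall>j\<in>{1..<n}. d j \<le> b \<and> (d j = b \<longrightarrow> (\<forall>i\<in>{1..<j}. d i = 0)))"

lemma repunit_digits_prefix: "repunit_digits b (Suc n) d \<Longrightarrow> repunit_digits b n d"
  by (auto simp: repunit_digits_def)

lemma repunit_digits_value_less:
  assumes "repunit_digits b (Suc n) d"
  shows "(\<Sum>i\<in>{1..n}. d i * rb b i) < rb b (Suc n)"
  using assms
proof (induction n)
  case 0
  then show ?case by (simp add: rb_Suc)
next
  case (Suc n)
  have prefix: "repunit_digits b (Suc n) d"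
    by (rule repunit_digits_prefix[OF Suc.prems])
  have d: "d (Suc n) \<le> b" "d (Suc n) = b \<Longrightarrow> \<forall>i\<in>{1..n}. d i = 0"
    using Suc.prems by (auto simp: repunit_digits_def)
  show ?case
  proof (cases "d (Suc n) = b")
    case True
    then show ?thesis
      using d by (simp add: rb_Suc[of b "Suc n"])
  next
    case False
    then have "Suc (d (Suc n)) * rb b (Suc n) \<le> b * rb b (Suc n)"
      using d by (intro mult_le_mono1) simp
    then show ?thesis
      using Suc.IH[OF prefix] by (simp add: rb_Suc[of b "Suc n"])
  qed
qed

text \<open>
  By the bound on the value of the lower digits, the top digit is the quotient of the value by the top
  repunit.
\<close>

lemma repunit_digits_unique:
  assumes "repunit_digits b (Suc n) d" "repunit_digits b (Suc n) d'"
    and "(\<Sum>i\<in>{1..n}. d i * rb b i) = (\<Sum>i\<in>{1..n}. d' i * rb b i)"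
    and "j \<in> {1..n}"
  shows "d j = d' j"
  using assms
proof (induction n)
  case 0
  then show ?case by simp
next
  case (Suc n)
  let ?s = "\<lambda>d. \<Sum>i\<in>{1..n}. d i * rb b i"
  have prefix: "repunit_digits b (Suc n) d" "repunit_digits b (Suc n) d'"
    using Suc.prems(1,2) by (auto intro: repunit_digits_prefix)
  note less = this[THEN repunit_digits_value_less]
  have eq: "?s d + d (Suc n) * rb b (Suc n) = ?s d' + d' (Suc n) * rb b (Suc n)"
    using Suc.prems(3) by simp
  have top: "d (Suc n) = d' (Suc n)"
    using arg_cong[OF eq, of "\<lambda>x. x div rb b (Suc n)"] less by simp
  moreover have "?s d = ?s d'"
    using eq top by simp
  ultimately show ?case
    using Suc.IH[OF prefix] Suc.prems(4) by (cases "j = Suc n") auto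
qed

section \<open>The minors and their monomials\<close>

locale repunit_matrix =
  fixes a b n :: nat
  assumes a_pos: "a > 0" and b_pos: "b > 0" and n_gt_1: "n > 1"
begin

definition A :: "nat \<Rightarrow> nat"
  where "A i = rb b n + a * rb b (i - 1)"

text \<open>
  The exponent of the entry of the second row in column \<open>q\<close>; the entry of the first row in column \<open>p\<close>
  has exponent \<open>Poly_Mapping.single p b\<close>.
\<close>

definition lower_row :: "nat \<Rightarrow> nat \<Rightarrow>\<^sub>0 nat"
  where "lower_row q = (if q < n then Poly_Mapping.single (q + 1) 1 else Poly_Mapping.single 1 (a + 1))"

text \<open>
  The \<open>2 \<times> 2\<close>-minor of columns \<open>i\<close> and \<open>j\<close> is the difference of two such products of an entry of the
  first row and an entry of the second row.
\<close>

definition term_exp :: "nat \<Rightarrow> nat \<Rightarrow> nat \<Rightarrow>\<^sub>0 nat"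
  where "term_exp p q = Poly_Mapping.single p b + lower_row q"

definition minor :: "nat \<Rightarrow> nat \<Rightarrow> 'k::field mpoly"
  where "minor i j = monomial (term_exp i j) - monomial (term_exp j i)"

definition minors :: "'k::field mpoly set"
  where "minors = {minor i j | i j. 1 \<le> i \<and> i < j \<and> j \<le> n}"

lemma minors2_matX: "minors2 n (matX a b n) = (minors :: 'k::field mpoly set)"
proof -
  have "matX a b n 1 i = (monomial (Poly_Mapping.single i b) :: 'k mpoly)"
    and "matX a b n 2 i = (monomial (lower_row i) :: 'k mpoly)" for i
    unfolding matX_def lower_row_def var_power by (simp_all add: var_def monomial_def)
  then show ?thesis
    unfolding minors2_def minors_def minor_def term_exp_def monomial_mult[symmetric] by simp
qed

lemma keys_lower_row: "q \<ge> 1 \<Longrightarrow> Poly_Mapping.keys (lower_row q) \<subseteq> {1..n}"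
  using n_gt_1 by (auto simp: lower_row_def)

lemma keys_term_exp:
  "p \<in> {1..n} \<Longrightarrow> q \<in> {1..n} \<Longrightarrow> Poly_Mapping.keys (term_exp p q) \<subseteq> {1..n}"
  using keys_lower_row[of q] b_pos by (auto simp: term_exp_def keys_add_nat)

text \<open>
  The last column fits the pattern of the others because \<open>(a + 1) * A 1 = rb b n + a * rb b n\<close>.
\<close>

lemma weight_A_lower_row:
  assumes "q \<in> {1..n}"
  shows "weight A (lower_row q) = rb b n + a * rb b q"
  using assms by (auto simp: lower_row_def A_def)

lemma weight_A_term_exp:
  assumes "p \<in> {1..n}" "q \<in> {1..n}"
  shows "weight A (term_exp p q) = weight A (term_exp q p)"
proof -
  obtain p' q' where "p = Suc p'" "q = Suc q'"
    using assms by (cases p; cases q) auto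
  then show ?thesis
    using assms by (simp add: term_exp_def weight_A_lower_row A_def rb_Suc algebra_simps)
qed

lemma minors_carrier: "minors \<subseteq> carrier (mpoly_ring n)"
proof -
  have "minor p q \<in> carrier (mpoly_ring n)" if "1 \<le> p" "p < q" "q \<le> n" for p q
    using keys_term_exp[of p q] keys_term_exp[of q p] that
      keys_diff[of "monomial (term_exp p q)" "monomial (term_exp q p)"]
    by (auto simp: minor_def monomial_def)
  then show ?thesis by (auto simp: minors_def)
qed

lemma minor_in_toric_ideal:
  assumes "p \<in> {1..n}" "q \<in> {1..n}"
  shows "minor p q \<in> toric_ideal n A"
  unfolding minor_def using assms
  by (intro binomial_in_toric_ideal keys_term_exp weight_A_term_exp)

lemma minors_in_toric_ideal: "minors \<subseteq> toric_ideal n A"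
  by (auto simp: minors_def intro!: minor_in_toric_ideal)

section \<open>The minors generate the toric ideal\<close>

text \<open>
  The monomials in which no product of \<open>b\<close> factors \<open>x\<^sub>q\<close> and a factor \<open>x\<^sub>p\<^sub>+\<^sub>1\<close> with \<open>1 \<le> p < q\<close> can be
  split off, that is, to which no minor can be applied as the rewrite rule
  \<open>x\<^sub>q\<^sup>b x\<^sub>p\<^sub>+\<^sub>1 \<mapsto> x\<^sub>p\<^sup>b x\<^sub>q\<^sub>+\<^sub>1\<close>.
\<close>

definition reduced :: "(nat \<Rightarrow>\<^sub>0 nat) \<Rightarrow> bool"
  where "reduced m \<longleftrightarrow> repunit_digits b n (\<lambda>j. Poly_Mapping.lookup m (Suc j))"

text \<open>
  The termination measure for this rewriting.  If \<open>w\<close> is a weight, then replacing \<open>x\<^sub>q\<^sup>b x\<^sub>p\<^sub>+\<^sub>1\<close> by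
  \<open>x\<^sub>p\<^sup>b x\<^sub>q\<^sub>+\<^sub>1\<close> lowers it if the differences \<open>w (j + 1) - b * w j\<close> are strictly decreasing in \<open>j\<close>;
  they are taken to be \<open>n - j\<close>.  Starting from \<open>w 1 = 0\<close> the power of \<open>x\<^sub>1\<close> in the last column has
  weight 0, which makes the inequality true for this column as well.
\<close>

primrec drop_weight :: "nat \<Rightarrow> nat"
  where "drop_weight 0 = 0"
  | "drop_weight (Suc j) = (if j = 0 then 0 else b * drop_weight j + (n - j))"

lemma drop_weight_decreases:
  assumes "1 \<le> p" "p < q" "q \<le> n"
  shows "weight drop_weight (term_exp p q) < weight drop_weight (term_exp q p)"
proof -
  have "weight drop_weight (lower_row p) = b * drop_weight p + (n - p)"
    using assms by (simp add: lower_row_def)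
  moreover have "weight drop_weight (lower_row q) \<le> b * drop_weight q + (n - q)"
    using assms by (auto simp: lower_row_def)
  moreover have "n - q < n - p" using assms by simp
  ultimately show ?thesis
    by (simp add: term_exp_def mult.commute)
qed

lemma not_reducedE:
  assumes "\<not> reduced m"
  obtains p q m' where "1 \<le> p" "p < q" "q \<le> n" "m = m' + term_exp q p"
proof -
  from assms obtain j where j: "j \<in> {1..<n}"
    "Poly_Mapping.lookup m (Suc j) > b \<or>
     Poly_Mapping.lookup m (Suc j) = b \<and> (\<exists>i\<in>{1..<j}. Poly_Mapping.lookup m (Suc i) \<noteq> 0)"
    unfolding reduced_def repunit_digits_def by (metis antisym_conv1 not_le)
  (* If the exponent exceeds b, the additional factor is the variable itself. *)
  have "\<exists>p\<in>{1..j}. Poly_Mapping.lookup m (Suc j) \<ge> b \<and>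
    Poly_Mapping.lookup m (Suc p) \<ge> 1 \<and> (p = j \<longrightarrow> Poly_Mapping.lookup m (Suc j) > b)"
    using j(2)
  proof (elim disjE)
    assume "Poly_Mapping.lookup m (Suc j) > b"
    then show ?thesis using j(1) by (intro bexI[of _ j]) auto
  next
    assume "Poly_Mapping.lookup m (Suc j) = b \<and> (\<exists>i\<in>{1..<j}. Poly_Mapping.lookup m (Suc i) \<noteq> 0)"
    then obtain i where "i \<in> {1..<j}" "Poly_Mapping.lookup m (Suc i) \<noteq> 0"
      "Poly_Mapping.lookup m (Suc j) = b" by blast
    then show ?thesis by (intro bexI[of _ i]) auto
  qed
  then obtain p where p: "p \<in> {1..j}" "Poly_Mapping.lookup m (Suc j) \<ge> b"
    "Poly_Mapping.lookup m (Suc p) \<ge> 1" "p = j \<Longrightarrow> Poly_Mapping.lookup m (Suc j) > b"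
    by blast
  have "lower_row p = Poly_Mapping.single (Suc p) 1"
    using p(1) j(1) by (simp add: lower_row_def)
  then have "m = (m - term_exp (Suc j) p) + term_exp (Suc j) p"
    using p by (intro poly_mapping_eqI)
      (auto simp: term_exp_def lookup_add lookup_minus lookup_single when_def)
  then show thesis
    using p(1) j(1) by (intro that[of p "Suc j"]) auto
qed

lemma reduces_to_normal_form:
  assumes J: "ideal J (mpoly_ring n)" "minors \<subseteq> J" and "Poly_Mapping.keys m \<subseteq> {1..n}"
  shows "\<exists>w. Poly_Mapping.keys w \<subseteq> {1..n} \<and> reduced w \<and> weight A w = weight A m \<and>
    monomial m - monomial w \<in> J"
  using assms(3)
proof (induction "weight drop_weight m" arbitrary: m rule: less_induct)
  case less
  show ?case
  proof (cases "reduced m")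
    case True
    then show ?thesis
      using less.prems ideal_mpoly_ring_closed(4)[OF J(1)] by (intro exI[of _ m]) auto
  next
    case False
    then obtain p q m' where pq: "1 \<le> p" "p < q" "q \<le> n" and m: "m = m' + term_exp q p"
      by (rule not_reducedE)
    define u where "u = m' + term_exp p q"
    have "Poly_Mapping.keys m' \<subseteq> {1..n}"
      using less.prems by (simp add: m keys_add_nat)
    moreover have "Poly_Mapping.keys (term_exp p q) \<subseteq> {1..n}"
      using pq by (intro keys_term_exp) auto
    ultimately have u: "Poly_Mapping.keys u \<subseteq> {1..n}" and m': "monomial m' \<in> carrier (mpoly_ring n)"
      by (simp_all add: u_def keys_add_nat monomial_def)
    have "weight drop_weight u < weight drop_weight m"
      using drop_weight_decreases[OF pq] by (simp add: u_def m)
    from less.hyps[OF this u] obtain w where w: "Poly_Mapping.keys w \<subseteq> {1..n}" "reduced w"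
      "weight A w = weight A u" "monomial u - monomial w \<in> J" by blast
    have "minor p q \<in> J"
      using J(2) pq by (auto simp: minors_def)
    then have "monomial m' * minor p q \<in> J"
      using ideal_mpoly_ring_closed(2)[OF J(1) _ m'] by blast
    then have "monomial u - monomial m \<in> J"
      by (simp add: minor_def right_diff_distrib monomial_mult u_def m)
    then have "(monomial u - monomial w) - (monomial u - monomial m) \<in> J"
      by (rule ideal_mpoly_ring_closed(3)[OF J(1) w(4)])
    moreover have "weight A u = weight A m"
      using weight_A_term_exp[of p q] pq by (simp add: u_def m)
    ultimately show ?thesis
      using w by (intro exI[of _ w]) auto
  qed
qed

text \<open>
  Write the weight as \<open>rb b n * T + a * S\<close>, where \<open>T\<close> is the total degree and \<open>S\<close> is the value of the
  greedy expansion given by the exponents of \<open>x\<^sub>2, \<dots>, x\<^sub>n\<close>.  As \<open>a\<close> is invertible modulo \<open>rb b n\<close>, the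
  weight determines \<open>S\<close> modulo \<open>rb b n\<close>; as \<open>S < rb b n\<close>, it determines \<open>S\<close>, hence these
  exponents, and finally the exponent of \<open>x\<^sub>1\<close>.
\<close>

lemma reduced_unique:
  assumes coprime: "coprime a (rb b n)"
    and u: "Poly_Mapping.keys u \<subseteq> {1..n}" "reduced u"
    and v: "Poly_Mapping.keys v \<subseteq> {1..n}" "reduced v"
    and eq: "weight A u = weight A v"
  shows "u = v"
proof -
  define T where "T m = (\<Sum>j<n. Poly_Mapping.lookup m (Suc j))" for m :: "nat \<Rightarrow>\<^sub>0 nat"
  define S where "S m = (\<Sum>j\<in>{1..n - 1}. Poly_Mapping.lookup m (Suc j) * rb b j)"
    for m :: "nat \<Rightarrow>\<^sub>0 nat"
  have n: "Suc (n - 1) = n" using n_gt_1 by simp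
  have split: "{..<n} = insert 0 {1..n - 1}" using n_gt_1 by auto
  have weight: "weight A m = rb b n * T m + a * S m" if "Poly_Mapping.keys m \<subseteq> {1..n}" for m
  proof -
    have "weight A m = (\<Sum>i\<in>{1..n}. A i * Poly_Mapping.lookup m i)"
      using that by (simp add: weight_superset)
    also have "\<dots> = (\<Sum>j<n. (rb b n + a * rb b j) * Poly_Mapping.lookup m (Suc j))"
      by (rule sum.reindex_bij_witness[of _ Suc "\<lambda>i. i - 1"]) (auto simp: A_def)
    also have "\<dots> = rb b n * T m + a * (\<Sum>j<n. rb b j * Poly_Mapping.lookup m (Suc j))"
      by (simp add: T_def distrib_right sum.distrib sum_distrib_left mult.assoc)
    also have "(\<Sum>j<n. rb b j * Poly_Mapping.lookup m (Suc j)) = S m"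
      unfolding split S_def by (simp add: mult.commute)
    finally show ?thesis .
  qed
  have less: "S m < rb b n" if "reduced m" for m
    using repunit_digits_value_less[of b "n - 1"] that n_gt_1 by (simp add: reduced_def S_def)
  have eq': "rb b n * T u + a * S u = rb b n * T v + a * S v"
    using eq u v by (simp add: weight)
  have "int a * (int (S u) - int (S v)) = int (rb b n) * (int (T v) - int (T u))"
    using arg_cong[OF eq', of int] by (simp add: algebra_simps)
  then have "int (rb b n) dvd int a * (int (S u) - int (S v))" by simp
  then have "int (rb b n) dvd int (S u) - int (S v)"
    using coprime by (subst (asm) coprime_dvd_mult_right_iff) (simp_all add: coprime_commute)
  moreover have "\<bar>int (S u) - int (S v)\<bar> < int (rb b n)"
    using less[OF u(2)] less[OF v(2)] by linarith
  ultimately have "S u = S v"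
    using dvd_imp_le_int[of "int (S u) - int (S v)" "int (rb b n)"] by fastforce
  then have digits: "Poly_Mapping.lookup u (Suc j) = Poly_Mapping.lookup v (Suc j)"
    if "j \<in> {1..n - 1}" for j
    using repunit_digits_unique[of b "n - 1"] u(2) v(2) that
    unfolding reduced_def S_def n by blast
  have "rb b n > 0"
    using rb_Suc[of b "n - 1"] n by simp
  then have "T u = T v"
    using eq' \<open>S u = S v\<close> by simp
  then have "Poly_Mapping.lookup u (Suc 0) = Poly_Mapping.lookup v (Suc 0)"
    using digits unfolding T_def split by simp
  with digits have lookup: "Poly_Mapping.lookup u (Suc j) = Poly_Mapping.lookup v (Suc j)"
    if "j < n" for j
    using that by (cases "j = 0") auto
  show ?thesis
  proof (rule poly_mapping_eqI)
    fix i
    show "Poly_Mapping.lookup u i = Poly_Mapping.lookup v i"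
    proof (cases "i \<in> {1..n}")
      case True
      then show ?thesis using lookup[of "i - 1"] by auto
    next
      case False
      then show ?thesis using u(1) v(1) by (metis in_keys_iff subsetD)
    qed
  qed
qed

text \<open>
  Two monomials of the same weight are congruent modulo the minors to reduced monomials of this weight,
  and there is only one.
\<close>

lemma genideal_minors:
  assumes "coprime a (rb b n)"
  shows "genideal (mpoly_ring n) minors = (toric_ideal n A :: 'k::field mpoly set)"
proof
  interpret R: cring "mpoly_ring n :: 'k mpoly ring" by (rule cring_mpoly_ring)
  have J: "ideal (genideal (mpoly_ring n) minors) (mpoly_ring n :: 'k mpoly ring)"
    by (rule R.genideal_ideal[OF minors_carrier])
  have gen: "minors \<subseteq> genideal (mpoly_ring n :: 'k mpoly ring) minors"
    by (rule R.genideal_self[OF minors_carrier])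
  show "genideal (mpoly_ring n) minors \<subseteq> (toric_ideal n A :: 'k mpoly set)"
    by (rule R.genideal_minimal[OF ideal_toric_ideal minors_in_toric_ideal])
  show "(toric_ideal n A :: 'k mpoly set) \<subseteq> genideal (mpoly_ring n) minors"
  proof (rule toric_ideal_subset[OF J])
    fix u v
    assume uv: "Poly_Mapping.keys u \<subseteq> {1..n}" "Poly_Mapping.keys v \<subseteq> {1..n}"
      "weight A u = weight A v"
    obtain u' where u': "Poly_Mapping.keys u' \<subseteq> {1..n}" "reduced u'" "weight A u' = weight A u"
      "monomial u - monomial u' \<in> genideal (mpoly_ring n :: 'k mpoly ring) minors"
      using reduces_to_normal_form[OF J gen uv(1)] by blast
    obtain v' where v': "Poly_Mapping.keys v' \<subseteq> {1..n}" "reduced v'" "weight A v' = weight A v"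
      "monomial v - monomial v' \<in> genideal (mpoly_ring n :: 'k mpoly ring) minors"
      using reduces_to_normal_form[OF J gen uv(2)] by blast
    have "u' = v'"
      using reduced_unique[OF assms u'(1,2) v'(1,2)] u'(3) v'(3) uv(3) by simp
    then show "monomial u - monomial v \<in> genideal (mpoly_ring n :: 'k mpoly ring) minors"
      using ideal_mpoly_ring_closed(3)[OF J u'(4) v'(4)] by simp
  qed
qed

section \<open>No minor can be omitted\<close>

lemma lower_row_dvd:
  assumes "m + lower_row q = lower_row j" "q \<in> {1..n}" "j \<in> {1..n}"
  shows "m = 0 \<and> q = j"
proof -
  have eq: "Poly_Mapping.lookup m k + Poly_Mapping.lookup (lower_row q) k =
      Poly_Mapping.lookup (lower_row j) k" for k
    by (simp flip: assms(1) lookup_add)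
  have "q = j"
    using eq[of "Suc q"] eq[of 1] assms(2,3) a_pos
    by (auto simp: lower_row_def lookup_single when_def split: if_splits)
  then show ?thesis using assms(1) by simp
qed

lemma lower_row_le: "Poly_Mapping.lookup (lower_row j) k \<le> a + 1"
  by (auto simp: lower_row_def lookup_single when_def)

lemma total_degree_term_exp:
  "total_degree (term_exp p q) = (if q < n then b + 1 else b + a + 1)"
  by (simp add: term_exp_def lower_row_def)

lemma term_exp_eq_iff:
  assumes "b \<ge> 2" "1 \<le> i" "i < j" "j \<le> n" "p \<in> {1..n}" "q \<in> {1..n}"
  shows "term_exp p q = term_exp j i \<longleftrightarrow> p = j \<and> q = i"
proof
  assume eq: "term_exp p q = term_exp j i"
  then have "Poly_Mapping.lookup (term_exp p q) p = Poly_Mapping.lookup (term_exp j i) p"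
    by simp
  then have p: "p = j"
    using assms by (auto simp: term_exp_def lookup_add lower_row_def lookup_single when_def split: if_splits)
  then have "0 + lower_row q = lower_row i"
    using eq by (simp add: term_exp_def)
  then have "q = i"
    using lower_row_dvd[of 0 q i] assms by auto
  with p show "p = j \<and> q = i" ..
qed simp

text \<open>
  In the graph on monomials whose edges are the minors other than that of columns \<open>i\<close> and \<open>j\<close>, the
  set \<open>C\<close> is the connected component of the second monomial of this minor, and it does not contain the
  first one.  Since all terms of all minors have total degree at least \<open>b + 1\<close>, multiples of minors by
  nonconstant monomials have no influence on \<open>C\<close>.  If \<open>b \<ge> 2\<close>, the component is a single monomial.  If
  \<open>b = 1\<close>, the minors of columns \<open>p\<close> and \<open>q\<close> with \<open>p + q = i + j\<close> and \<open>q < n\<close> form the path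
  \<open>x\<^sub>p x\<^sub>q\<^sub>+\<^sub>1 \<rightarrow> x\<^sub>p\<^sub>+\<^sub>1 x\<^sub>q\<close> towards the middle, and \<open>C\<close> is the part of this path on the inner side of the
  missing edge; for \<open>j = n\<close> it is the whole path.
\<close>

lemma separating_set:
  assumes ij: "1 \<le> i" "i < j" "j \<le> n"
  obtains C where "term_exp j i \<in> C" "term_exp i j \<notin> C" "\<And>u. u \<in> C \<Longrightarrow> total_degree u = b + 1"
    "\<And>p q. 1 \<le> p \<Longrightarrow> p < q \<Longrightarrow> q \<le> n \<Longrightarrow> (p, q) \<noteq> (i, j) \<Longrightarrow>
      term_exp p q \<in> C \<longleftrightarrow> term_exp q p \<in> C"
proof (cases "b \<ge> 2")
  case True
  show thesis
  proof (rule that[of "{term_exp j i}"])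
    show "term_exp i j \<notin> {term_exp j i}"
      using term_exp_eq_iff[OF True ij, of i j] ij by auto
    show "total_degree u = b + 1" if "u \<in> {term_exp j i}" for u
      using that ij by (simp add: total_degree_term_exp)
    show "term_exp p q \<in> {term_exp j i} \<longleftrightarrow> term_exp q p \<in> {term_exp j i}"
      if "1 \<le> p" "p < q" "q \<le> n" "(p, q) \<noteq> (i, j)" for p q
      using that ij term_exp_eq_iff[OF True ij, of p q] term_exp_eq_iff[OF True ij, of q p] by auto
  qed simp
next
  case False
  then have b: "b = 1" using b_pos by simp
  define C where "C = {u. Poly_Mapping.keys u \<subseteq> {i<..} \<and> total_degree u = 2 \<and>
    weight (\<lambda>k. k) u = i + j + 1}"
  have mem: "term_exp p q \<in> C \<longleftrightarrow> q < n \<and> i < p \<and> i < q + 1 \<and> p + q = i + j" for p q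
    using a_pos unfolding C_def term_exp_def lower_row_def unfolding b
    by (auto simp: keys_add_nat)
  show thesis
  proof (rule that[of C])
    show "term_exp j i \<in> C" "term_exp i j \<notin> C"
      using ij by (auto simp: mem)
    show "total_degree u = b + 1" if "u \<in> C" for u
      using that by (simp add: C_def b)
    show "term_exp p q \<in> C \<longleftrightarrow> term_exp q p \<in> C"
      if "1 \<le> p" "p < q" "q \<le> n" "(p, q) \<noteq> (i, j)" for p q
      using that ij by (auto simp: mem)
  qed
qed

lemma separating_functional:
  fixes f :: "'k::field mpoly"
  assumes "f \<in> minors"
  obtains C where "coeff_sum C f \<noteq> 0"
    "\<And>g m c. g \<in> minors \<Longrightarrow> m \<noteq> 0 \<or> g \<noteq> f \<Longrightarrow> coeff_sum C (Poly_Mapping.single m c * g) = 0"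
proof -
  from assms obtain i j where f: "f = minor i j" and ij: "1 \<le> i" "i < j" "j \<le> n"
    by (auto simp: minors_def)
  obtain C where C: "term_exp j i \<in> C" "term_exp i j \<notin> C"
    "\<And>u. u \<in> C \<Longrightarrow> total_degree u = b + 1"
    "\<And>p q. 1 \<le> p \<Longrightarrow> p < q \<Longrightarrow> q \<le> n \<Longrightarrow> (p, q) \<noteq> (i, j) \<Longrightarrow>
      term_exp p q \<in> C \<longleftrightarrow> term_exp q p \<in> C"
    using separating_set[OF ij] by blast
  show thesis
  proof (rule that[of C])
    show "coeff_sum C f \<noteq> 0"
      using C(1,2) by (simp add: f minor_def monomial_def)
    fix g :: "'k mpoly" and m :: "nat \<Rightarrow>\<^sub>0 nat" and c :: 'k
    assume g: "g \<in> minors" "m \<noteq> 0 \<or> g \<noteq> f"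
    then obtain p q where g_eq: "g = minor p q" and pq: "1 \<le> p" "p < q" "q \<le> n"
      by (auto simp: minors_def)
    have "m + term_exp p' q' \<notin> C" if "m \<noteq> 0" for p' q'
    proof
      assume "m + term_exp p' q' \<in> C"
      then have "total_degree m + total_degree (term_exp p' q') = b + 1"
        using C(3) by fastforce
      moreover have "total_degree (term_exp p' q') \<ge> b + 1"
        by (simp add: total_degree_term_exp)
      ultimately have "total_degree m = 0" by linarith
      with that show False by (simp add: total_degree_eq_0_iff)
    qed
    then have "m + term_exp p q \<in> C \<longleftrightarrow> m + term_exp q p \<in> C"
      using C(4)[OF pq] g(2) by (cases "m = 0") (auto simp: f g_eq)
    then show "coeff_sum C (Poly_Mapping.single m c * g) = 0"
      by (simp add: g_eq minor_def single_times_binomial)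
  qed
qed

lemma minimally_generates_minors:
  assumes "coprime a (rb b n)"
  shows "minimally_generates (mpoly_ring n) minors (toric_ideal n A :: 'k::field mpoly set)"
proof (rule minimally_generates_if_separated[OF minors_carrier genideal_minors[OF assms]])
  fix f :: "'k mpoly" assume "f \<in> minors"
  then show "\<exists>C. coeff_sum C f \<noteq> 0 \<and>
      (\<forall>g\<in>minors - {f}. \<forall>m c. coeff_sum C (Poly_Mapping.single m c * g) = 0)"
    by (rule separating_functional) blast
qed

section \<open>Uniqueness of the minimal binomial system\<close>

lemma keys_term_exp_disjoint:
  assumes "1 \<le> i" "i < j" "j \<le> n"
  shows "Poly_Mapping.keys (term_exp i j) \<inter> Poly_Mapping.keys (term_exp j i) = {}"
  using assms b_pos by (auto simp: term_exp_def lower_row_def keys_add_nat split: if_splits)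

lemma term_exp_neq:
  assumes "1 \<le> i" "i < j" "j \<le> n"
  shows "term_exp i j \<noteq> term_exp j i"
proof
  assume "term_exp i j = term_exp j i"
  with keys_term_exp_disjoint[OF assms] have "Poly_Mapping.keys (term_exp i j) = {}" by simp
  then show False using b_pos by (simp add: term_exp_def keys_add_nat)
qed

lemma is_binomial_minor:
  assumes "1 \<le> i" "i < j" "j \<le> n"
  shows "is_binomial (minor i j)"
  unfolding is_binomial_def
  by (rule exI[of _ "term_exp i j"], rule exI[of _ "term_exp j i"], rule exI[of _ 1],
      rule exI[of _ "- 1"]) (use term_exp_neq[OF assms] in \<open>simp add: minor_def monomial_def single_uminus\<close>)

lemma minimal_binomial_system_minors:
  assumes "coprime a (rb b n)"
  shows "minimal_binomial_system n (toric_ideal n A :: 'k::field mpoly set) minors"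
  unfolding minimal_binomial_system_def
  using minimally_generates_minors[OF assms] is_binomial_minor by (auto simp: minors_def)

text \<open>
  If \<open>a + 1 < b\<close>, a variable with exponent at least \<open>b\<close> in a term of a minor comes from the first row,
  even when the power of \<open>x\<^sub>1\<close> in the second row is present.  So no term of a minor divides another.
\<close>

lemma term_exp_dvd:
  assumes "a + 1 < b" "m + term_exp p q = term_exp i j" "q \<in> {1..n}" "j \<in> {1..n}"
  shows "m = 0 \<and> p = i \<and> q = j"
proof -
  have "b \<le> Poly_Mapping.lookup (m + term_exp p q) p"
    by (simp add: term_exp_def lookup_add)
  moreover have "Poly_Mapping.lookup (term_exp i j) p < b" if "p \<noteq> i"
    using that lower_row_le[of j p] assms(1) by (simp add: term_exp_def lookup_add lookup_single)
  ultimately have p: "p = i"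
    using assms(2) by fastforce
  then have "Poly_Mapping.single i b + (m + lower_row q) = Poly_Mapping.single i b + lower_row j"
    using assms(2) by (simp add: term_exp_def ac_simps)
  then have "m + lower_row q = lower_row j"
    by (rule add_left_imp_eq)
  with p lower_row_dvd assms(3,4) show ?thesis by blast
qed

text \<open>
  Let \<open>u\<close> and \<open>v\<close> be the two monomials of the minor.  By \<open>term_exp_dvd\<close> no other minor can be applied
  to them, so the functional that adds the coefficients of \<open>u\<close> and \<open>v\<close> kills the ideal.  Some multiple
  \<open>m * g\<close> of an element \<open>g\<close> of the system must involve \<open>u\<close>.  As this binomial is killed by the
  functional, it is a scalar multiple of \<open>u - v\<close>; and \<open>m = 1\<close>, because \<open>u\<close> and \<open>v\<close> are coprime.
\<close>

lemma minor_indispensable: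
  fixes B :: "'k::field mpoly set"
  assumes coprime: "coprime a (rb b n)" and less: "a + 1 < b" and ij: "1 \<le> i" "i < j" "j \<le> n"
    and B: "minimal_binomial_system n (toric_ideal n A) B"
  shows "\<exists>c. c \<noteq> 0 \<and> const c * minor i j \<in> B"
proof -
  interpret R: cring "mpoly_ring n :: 'k mpoly ring" by (rule cring_mpoly_ring)
  define u where "u = term_exp i j"
  define v where "v = term_exp j i"
  have uv: "u \<noteq> v" using term_exp_neq[OF ij] by (simp add: u_def v_def)
  have Bc: "B \<subseteq> carrier (mpoly_ring n)" and Bg: "genideal (mpoly_ring n) B = toric_ideal n A"
    and Bb: "\<And>g. g \<in> B \<Longrightarrow> is_binomial g"
    using B by (auto simp: minimal_binomial_system_def minimally_generates_def)
  have fibre: "coeff_sum {u, v} p = 0" if "p \<in> toric_ideal n A" for p :: "'k mpoly"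
  proof (rule coeff_sum_vanishes_on_genideal[OF minors_carrier])
    show "p \<in> genideal (mpoly_ring n) minors"
      using that genideal_minors[OF coprime] by blast
    fix g :: "'k mpoly" and m and c :: 'k
    assume "g \<in> minors"
    then obtain p q where g: "g = minor p q" and pq: "1 \<le> p" "p < q" "q \<le> n"
      by (auto simp: minors_def)
    have "m + term_exp p' q' \<in> {u, v} \<longleftrightarrow> m = 0 \<and> ((p', q') = (i, j) \<or> (p', q') = (j, i))"
      if "p' \<in> {p, q}" "q' \<in> {p, q}" for p' q'
      using that pq ij term_exp_dvd[OF less, of m p' q' i j] term_exp_dvd[OF less, of m p' q' j i]
      by (auto simp: u_def v_def)
    then have "m + term_exp p q \<in> {u, v} \<longleftrightarrow> m + term_exp q p \<in> {u, v}"
      by auto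
    then show "coeff_sum {u, v} (Poly_Mapping.single m c * g) = 0"
      by (simp only: g minor_def single_times_binomial coeff_sum_diff coeff_sum_single diff_self)
  qed
  have "\<exists>g\<in>B. \<exists>m c. Poly_Mapping.keys m \<subseteq> {1..n} \<and>
      coeff_sum {u} (Poly_Mapping.single m c * g) \<noteq> 0"
  proof (rule ccontr)
    assume no: "\<not> ?thesis"
    have "coeff_sum {u} (minor i j :: 'k mpoly) = 0"
    proof (rule coeff_sum_vanishes_on_genideal[OF Bc])
      show "minor i j \<in> genideal (mpoly_ring n :: 'k mpoly ring) B"
        unfolding Bg using ij by (intro minor_in_toric_ideal) auto
    qed (use no in blast)
    then show False
      using uv by (simp add: minor_def monomial_def flip: u_def v_def)
  qed
  then obtain g m c where g: "g \<in> B" and m: "Poly_Mapping.keys m \<subseteq> {1..n}"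
    and ne: "coeff_sum {u} (Poly_Mapping.single m c * g) \<noteq> 0" by blast
  from Bb[OF g] obtain s t d e where st: "s \<noteq> t" "d \<noteq> 0" "e \<noteq> 0"
    and g_eq: "g = Poly_Mapping.single s d + Poly_Mapping.single t e"
    unfolding is_binomial_def by blast
  have mult: "Poly_Mapping.single m c * g =
      Poly_Mapping.single (m + s) (c * d) + Poly_Mapping.single (m + t) (c * e)"
    by (simp add: g_eq distrib_left mult_single)
  have "c \<noteq> 0" using ne by auto
  have "g \<in> toric_ideal n A"
    using R.genideal_self[OF Bc] g Bg by blast
  moreover have "Poly_Mapping.single m c \<in> carrier (mpoly_ring n)"
    using m by simp
  ultimately have "Poly_Mapping.single m c * g \<in> toric_ideal n A"
    by (rule ideal_mpoly_ring_closed(2)[OF ideal_toric_ideal])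
  from fibre[OF this]
  have cancel: "(if m + s \<in> {u, v} then c * d else 0) + (if m + t \<in> {u, v} then c * e else 0) = 0"
    by (simp only: mult coeff_sum_add coeff_sum_single)
  have hit: "m + s = u \<or> m + t = u"
    using ne by (auto simp: mult split: if_splits)
  have both: "m + s \<in> {u, v}" "m + t \<in> {u, v}"
    using cancel hit \<open>c \<noteq> 0\<close> st by (auto split: if_splits)
  have "c * (d + e) = 0" using cancel both by (simp add: distrib_left)
  then have e: "e = - d" using \<open>c \<noteq> 0\<close> by (simp add: eq_neg_iff_add_eq_0 add.commute)
  have cases: "m + s = u \<and> m + t = v \<or> m + s = v \<and> m + t = u"
    using both hit st(1) by auto
  have "Poly_Mapping.keys m \<subseteq> Poly_Mapping.keys u \<inter> Poly_Mapping.keys v"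
    using cases by (auto simp: keys_add_nat)
  then have "m = 0"
    using keys_term_exp_disjoint[OF ij] by (simp add: u_def v_def)
  then have "s = u \<and> t = v \<or> s = v \<and> t = u" using cases by simp
  moreover have "const x * minor i j = Poly_Mapping.single u x - Poly_Mapping.single v x" for x :: 'k
    by (simp add: const_def minor_def single_times_binomial u_def v_def)
  ultimately have "g = const d * minor i j \<or> g = const (- d) * minor i j"
    by (auto simp: g_eq e single_uminus)
  then show ?thesis using g st(2) by (metis neg_equal_0_iff_equal)
qed

text \<open>
  Every minimal binomial system contains the minors up to scalars, and by minimality it contains
  nothing else.
\<close>

lemma unique_if_less:
  assumes coprime: "coprime a (rb b n)" and less: "a + 1 < b"
  shows "has_unique_minimal_binomial_system n (toric_ideal n A :: 'k::field mpoly set)"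
  unfolding has_unique_minimal_binomial_system_def
proof (intro exI[of _ minors] conjI allI impI)
  show "minimal_binomial_system n (toric_ideal n A) (minors :: 'k mpoly set)"
    by (rule minimal_binomial_system_minors[OF coprime])
  fix B :: "'k mpoly set"
  assume B: "minimal_binomial_system n (toric_ideal n A) B"
  interpret R: cring "mpoly_ring n :: 'k mpoly ring" by (rule cring_mpoly_ring)
  have Bc: "B \<subseteq> carrier (mpoly_ring n)" and Bg: "genideal (mpoly_ring n) B = toric_ideal n A"
    and Bm: "\<And>T. T \<subset> B \<Longrightarrow> genideal (mpoly_ring n) T \<noteq> toric_ideal n A"
    using B by (auto simp: minimal_binomial_system_def minimally_generates_def)
  have scaled: "\<exists>c. c \<noteq> 0 \<and> const c * f \<in> B" if "f \<in> minors" for f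
    using that minor_indispensable[OF coprime less _ _ _ B] by (auto simp: minors_def)
  define T where "T = {g \<in> B. \<exists>c. c \<noteq> 0 \<and> const c * g \<in> minors}"
  have TB: "T \<subseteq> B" by (auto simp: T_def)
  then have Tc: "T \<subseteq> carrier (mpoly_ring n)" using Bc by blast
  have "minors \<subseteq> genideal (mpoly_ring n) T"
  proof
    fix f :: "'k mpoly" assume f: "f \<in> minors"
    then obtain c where c: "c \<noteq> 0" "const c * f \<in> B" using scaled by blast
    have "const (inverse c) * (const c * f) \<in> minors" using f unfolding const_inverse_mult[OF c(1)] .
    then have "const c * f \<in> T"
      using c by (auto simp: T_def intro!: exI[of _ "inverse c"])
    then have "const c * f \<in> genideal (mpoly_ring n) T"
      using R.genideal_self[OF Tc] by blast
    then have "const (inverse c) * (const c * f) \<in> genideal (mpoly_ring n) T"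
      by (rule ideal_mpoly_ring_closed(2)[OF R.genideal_ideal[OF Tc] _ const_carrier])
    then show "f \<in> genideal (mpoly_ring n) T" unfolding const_inverse_mult[OF c(1)] .
  qed
  then have "toric_ideal n A \<subseteq> genideal (mpoly_ring n :: 'k mpoly ring) T"
    using R.genideal_minimal[OF R.genideal_ideal[OF Tc]] genideal_minors[OF coprime] by blast
  moreover have "genideal (mpoly_ring n) T \<subseteq> toric_ideal n A"
    using R.subset_Idl_subset[OF Bc TB] Bg by blast
  ultimately have "T = B"
    using Bm[of T] TB by blast
  then show "equal_up_to_scalars minors B"
    using scaled unfolding equal_up_to_scalars_def T_def by blast
qed

text \<open>
  The functional that separates a minor from the others also kills the nonconstant multiples of that
  minor, and so it does not notice whether \<open>f\<close> has been changed by \<open>monomial h * g\<close>.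
\<close>

lemma minimally_generates_exchange:
  fixes f g :: "'k::field mpoly"
  assumes coprime: "coprime a (rb b n)" and fg: "f \<in> minors" "g \<in> minors" "g \<noteq> f"
    and h: "h \<noteq> 0" "Poly_Mapping.keys h \<subseteq> {1..n}"
  shows "minimally_generates (mpoly_ring n)
    (insert (f - monomial h * g) (minors - {f})) (toric_ideal n A)"
proof -
  interpret R: cring "mpoly_ring n :: 'k mpoly ring" by (rule cring_mpoly_ring)
  define f' where "f' = f - monomial h * g"
  define B where "B = insert f' (minors - {f})"
  have mult_f': "coeff_sum C (Poly_Mapping.single m c * f') =
      coeff_sum C (Poly_Mapping.single m c * f) - coeff_sum C (Poly_Mapping.single (m + h) c * g)"
    for C m c
    by (simp add: f'_def right_diff_distrib monomial_def mult_single flip: mult.assoc)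
  have shift: "m + h \<noteq> 0" for m
    using h(1) by (simp add: total_degree_eq_0_iff[symmetric])
  have M: "ideal (genideal (mpoly_ring n) minors) (mpoly_ring n :: 'k mpoly ring)"
    by (rule R.genideal_ideal[OF minors_carrier])
  have self: "minors \<subseteq> genideal (mpoly_ring n :: 'k mpoly ring) minors"
    by (rule R.genideal_self[OF minors_carrier])
  have hg: "monomial h * g \<in> genideal (mpoly_ring n) minors"
    by (rule ideal_mpoly_ring_closed(2)[OF M subsetD[OF self fg(2)] monomial_carrier[OF h(2)]])
  have "f' \<in> genideal (mpoly_ring n) minors"
    unfolding f'_def by (rule ideal_mpoly_ring_closed(3)[OF M subsetD[OF self fg(1)] hg])
  then have BM: "B \<subseteq> genideal (mpoly_ring n) minors"
    using self by (auto simp: B_def)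
  then have Bc: "B \<subseteq> carrier (mpoly_ring n)"
    using ideal_mpoly_ring_closed(5)[OF M] by blast
  have BI: "ideal (genideal (mpoly_ring n) B) (mpoly_ring n :: 'k mpoly ring)"
    by (rule R.genideal_ideal[OF Bc])
  have B_self: "B \<subseteq> genideal (mpoly_ring n) B"
    by (rule R.genideal_self[OF Bc])
  have "g \<in> genideal (mpoly_ring n) B" "f' \<in> genideal (mpoly_ring n) B"
    using B_self fg by (auto simp: B_def)
  then have "f' + monomial h * g \<in> genideal (mpoly_ring n) B"
    using ideal_mpoly_ring_closed(1,2)[OF BI] monomial_carrier[OF h(2)] by blast
  then have "minors \<subseteq> genideal (mpoly_ring n) B"
    using B_self by (auto simp: f'_def B_def)
  then have B_gen: "genideal (mpoly_ring n) B = toric_ideal n A"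
    unfolding genideal_minors[OF coprime, symmetric]
    using R.genideal_minimal[OF BI] R.genideal_minimal[OF M BM] by blast
  have "minimally_generates (mpoly_ring n) B (toric_ideal n A)"
  proof (rule minimally_generates_if_separated[OF Bc B_gen])
    fix z assume z: "z \<in> B"
    show "\<exists>C. coeff_sum C z \<noteq> 0 \<and>
        (\<forall>p\<in>B - {z}. \<forall>m c. coeff_sum C (Poly_Mapping.single m c * p) = 0)"
    proof (cases "z = f'")
      case True
      obtain C where C: "coeff_sum C f \<noteq> 0"
        "\<And>p m c. p \<in> minors \<Longrightarrow> m \<noteq> 0 \<or> p \<noteq> f \<Longrightarrow> coeff_sum C (Poly_Mapping.single m c * p) = 0"
        using separating_functional[OF fg(1)] by blast
      have "coeff_sum C (monomial h * g) = 0"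
        unfolding monomial_def by (rule C(2)[OF fg(2)]) (simp add: h(1))
      then have "coeff_sum C z \<noteq> 0"
        using C(1) by (simp add: True f'_def)
      moreover have "\<forall>p\<in>B - {z}. \<forall>m c. coeff_sum C (Poly_Mapping.single m c * p) = 0"
        using C(2) by (auto simp: B_def True)
      ultimately show ?thesis by blast
    next
      case False
      then have z': "z \<in> minors" "z \<noteq> f" using z by (auto simp: B_def)
      obtain C where C: "coeff_sum C z \<noteq> 0"
        "\<And>p m c. p \<in> minors \<Longrightarrow> m \<noteq> 0 \<or> p \<noteq> z \<Longrightarrow> coeff_sum C (Poly_Mapping.single m c * p) = 0"
        using separating_functional[OF z'(1)] by blast
      (* The second summand of a multiple of f' vanishes even for z = g, because m + h is not 0. *)
      have "coeff_sum C (Poly_Mapping.single m c * f') = 0" for m c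
        unfolding mult_f' using C(2)[OF fg(1)] C(2)[OF fg(2)] z'(2) shift by auto
      then have "\<forall>p\<in>B - {z}. \<forall>m c. coeff_sum C (Poly_Mapping.single m c * p) = 0"
        using C(2) by (auto simp: B_def)
      with C(1) show ?thesis by blast
    qed
  qed
  then show ?thesis by (simp add: B_def f'_def)
qed

text \<open>
  If \<open>b \<le> a + 1\<close>, the monomial \<open>x\<^sub>3\<^sup>b x\<^sub>1\<^sup>a\<^sup>+\<^sup>1\<close> of the minor \<open>f\<close> of columns 3 and \<open>n\<close> is divisible by the
  monomial \<open>x\<^sub>1\<^sup>b x\<^sub>3\<close> of the minor \<open>g\<close> of columns 1 and 2.  Replacing that divisor by the other monomial
  of \<open>g\<close> turns \<open>f\<close> into a different binomial \<open>f'\<close>, and exchanging \<open>f\<close> for \<open>f'\<close> gives a second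
  minimal binomial system.  Column 2 would not do in place of column 3, as \<open>x\<^sub>1\<^sup>b x\<^sub>2\<close> is not a
  monomial of any minor; so the argument needs a third column that is not the last.
\<close>

lemma not_unique_if_ge:
  assumes coprime: "coprime a (rb b n)" and ge: "b \<le> a + 1" and n: "n > 3"
  shows "\<not> has_unique_minimal_binomial_system n (toric_ideal n A :: 'k::field mpoly set)"
proof (rule notI)
  define h where "h = Poly_Mapping.single 3 (b - 1) + Poly_Mapping.single (1::nat) (a + 1 - b)"
  define y where "y = h + term_exp 2 1"
  define f :: "'k mpoly" where "f = minor 3 n"
  define g :: "'k mpoly" where "g = minor 1 2"
  define f' where "f' = f - monomial h * g"
  define B where "B = insert f' (minors - {f})"
  have h_term: "h + term_exp 1 2 = term_exp 3 n"
    using ge n b_pos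
    by (intro poly_mapping_eqI)
       (auto simp: h_def term_exp_def lower_row_def lookup_add lookup_single when_def)
  have f'_eq: "f' = monomial y - monomial (term_exp n 3)"
    by (simp add: f'_def f_def g_def minor_def right_diff_distrib monomial_mult y_def h_term
        del: One_nat_def)
  have "total_degree h = a"
    using ge b_pos by (simp add: h_def)
  then have h0: "h \<noteq> 0" using a_pos total_degree_eq_0_iff[of h] by auto
  (* The exponent of the second variable distinguishes the monomials compared below. *)
  have y2: "Poly_Mapping.lookup y 2 = b + 1"
    using n by (simp add: y_def h_def term_exp_def lower_row_def lookup_add lookup_single)
  have y_neq: "y \<noteq> term_exp n 3" "y \<noteq> term_exp 3 n"
    using y2 n by (auto simp: term_exp_def lower_row_def lookup_add lookup_single)
  have fg: "f \<in> minors" "g \<in> minors"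
    using n unfolding minors_def f_def g_def by fastforce+
  have h_keys: "Poly_Mapping.keys h \<subseteq> {1..n}"
    using n by (auto simp: h_def keys_add_nat)
  have g_neq: "g \<noteq> f"
  proof
    have "term_exp 3 n \<noteq> term_exp 1 2"
      using h0 h_term by auto
    moreover have "term_exp 3 n \<noteq> term_exp 2 1"
    proof -
      have "Poly_Mapping.lookup (term_exp 3 n) 2 < Poly_Mapping.lookup (term_exp 2 1) 2"
        using n by (simp add: term_exp_def lower_row_def lookup_add lookup_single)
      then show ?thesis by auto
    qed
    moreover have "term_exp 3 n \<noteq> term_exp n 3"
      using n by (intro term_exp_neq) auto
    moreover assume "g = f"
    then have "coeff_sum {term_exp 3 n} g = coeff_sum {term_exp 3 n} f" by simp
    ultimately show False
      by (simp add: f_def g_def minor_def monomial_def del: One_nat_def)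
  qed
  have "minimally_generates (mpoly_ring n) B (toric_ideal n A)"
    unfolding B_def f'_def by (rule minimally_generates_exchange[OF coprime fg g_neq h0 h_keys])
  moreover have "is_binomial f'"
    unfolding is_binomial_def
    by (rule exI[of _ y], rule exI[of _ "term_exp n 3"], rule exI[of _ 1], rule exI[of _ "- 1"])
       (use y_neq in \<open>simp add: f'_eq monomial_def single_uminus\<close>)
  ultimately have B: "minimal_binomial_system n (toric_ideal n A) B"
    using minimal_binomial_system_minors[OF coprime, where 'k = 'k]
    by (auto simp: minimal_binomial_system_def B_def)

  assume "has_unique_minimal_binomial_system n (toric_ideal n A :: 'k mpoly set)"
  then obtain B\<^sub>0 :: "'k mpoly set"
    where "equal_up_to_scalars B\<^sub>0 minors" "equal_up_to_scalars B\<^sub>0 B"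
    using B minimal_binomial_system_minors[OF coprime]
    unfolding has_unique_minimal_binomial_system_def by blast
  then obtain c d where cd: "c \<noteq> 0" "d \<noteq> 0" "const d * (const c * f) \<in> B"
    using fg(1) unfolding equal_up_to_scalars_def by meson
  have scaled: "const d * (const c * f) = const (d * c) * f"
    by (simp add: const_def mult_single flip: mult.assoc)
  obtain C where C: "coeff_sum C f \<noteq> 0"
    "\<And>p m c. p \<in> minors \<Longrightarrow> m \<noteq> 0 \<or> p \<noteq> f \<Longrightarrow> coeff_sum C (Poly_Mapping.single m c * p) = 0"
    using separating_functional[OF fg(1)] by blast
  (* No minor other than f is a multiple of f by a scalar. *)
  have "const (d * c) * f = f'"
  proof (rule ccontr)
    assume "const (d * c) * f \<noteq> f'"
    then have "const (d * c) * f \<in> minors - {f}"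
      using cd(3) by (auto simp: B_def scaled)
    then have "coeff_sum C (const (inverse (d * c)) * (const (d * c) * f)) = 0"
      unfolding const_def[of "inverse (d * c)"] by (intro C(2)) auto
    moreover have "const (inverse (d * c)) * (const (d * c) * f) = f"
      by (rule const_inverse_mult) (use cd in simp)
    ultimately show False using C(1) by (simp only:)
  qed
  moreover have "coeff_sum {y} f' = 1"
    using y_neq by (simp add: f'_eq monomial_def)
  moreover have "coeff_sum {y} (const (d * c) * f) = 0"
    unfolding const_def f_def minor_def single_times_binomial using y_neq by simp
  ultimately show False by simp
qed

end

theorem corollary9:
  fixes a b n :: nat
    and A :: "nat \<Rightarrow> nat"
    and I :: "'k::field mpoly set"
  assumes "a > 0" and "b > 0" and "n > 1"
    and A_def: "\<And>i. i \<in> {1..n} \<Longrightarrow> A i = rb b n + a * rb b (i - 1)"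
    and I_def: "I = toric_ideal n A"
    and gcd: "gcd a (rb b n) = 1"
  shows "minimally_generates (mpoly_ring n) (minors2 n (matX a b n)) I
    \<and> (n > 3 \<longrightarrow> (has_unique_minimal_binomial_system n I \<longleftrightarrow> int a < int b - 1))"
proof -
  interpret M: repunit_matrix a b n
    using assms(1-3) by unfold_locales
  have I: "I = toric_ideal n M.A"
    unfolding I_def by (rule toric_ideal_cong) (simp add: A_def M.A_def)
  have coprime: "coprime a (rb b n)"
    using gcd by (simp add: coprime_iff_gcd_eq_1)
  have less: "int a < int b - 1 \<longleftrightarrow> a + 1 < b" by linarith
  have "minimally_generates (mpoly_ring n) (minors2 n (matX a b n)) I"
    unfolding I M.minors2_matX by (rule M.minimally_generates_minors[OF coprime])
  moreover have "has_unique_minimal_binomial_system n I \<longleftrightarrow> a + 1 < b" if "n > 3"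
    using M.unique_if_less[OF coprime] M.not_unique_if_ge[OF coprime _ that]
    unfolding I by (meson not_le)
  ultimately show ?thesis
    unfolding less by blast
qed

end
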